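(* Let $\Gamma$ be a generalized ring. For centrally $\Gamma$-graded sets $M_1,M_2$ let $$\beta_{M_1,M_2}:M_1\times_z M_2\to M_2\times_z M_1,\qquad [x_1,x_2]\mapsto z\bigl(d(x_2)\cdot d(x_1),[x_2,x_1]\bigr).$$ Then the (well-defined) braiding maps $\beta_{M_1,M_2}$ are isomorphisms of centrally $\Gamma$-graded sets and define a structure of (strict) braided monoidal category on the monoidal category of centrally $\Gamma$-graded sets with product $\times_z$ (strict with respect to the usual set-theoretic identification of iterated Cartesian products). If the generalized ring product is skew, meaning that $ab+ba=0$ for all $a,b\in\Gamma$, then this structure is symmetric, i.e., $\beta_{M_1,M_2}^{-1}=\beta_{M_2,M_1}$ for all $M_1,M_2$.
   Context: A generalized ring is an abelian group $(\Gamma,+)$ with a bi-additive map $\Gamma^2\to\Gamma$, $(a,b)\mapsto ab=a\cdot b$ (no associativity, commutativity or unit required). A centrally $\Gamma$-graded set is a set $M$ with a map $d:M\to\Gamma$ and a left action $z:\Gamma\times M\to M$, $(x,m)\mapsto z(x,m)=x.m$, of the group $(\Gamma,+)$ with $d(x.m)=d(m)$. Morphisms are maps preserving $d$ and commuting with the $\Gamma$-action. The product $M_1\times_z M_2$ is the quotient of $M_1\times M_2$ by the relation $(x.m_1,m_2)\sim(m_1,x.m_2)$ ($x\in\Gamma$), with classes $[m_1,m_2]$, grading $d([m_1,m_2])=d(m_1)+d(m_2)$ and action $x.[m_1,m_2]=[x.m_1,m_2]=[m_1,x.m_2]$; on morphisms $(f_1\times_z f_2)[x_1,x_2]=[f_1(x_1),f_2(x_2)]$.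 This is a monoidal category, with associativity induced by $(M_1\times M_2)\times M_3=M_1\times(M_2\times M_3)$ and unit $E=\Gamma$ with $d=0$ and $x.m=x+m$. *)

theory Defs
  imports Main "HOL-Library.FuncSet"
begin

section \<open>Braided monoidal categories\<close>

record ('o, 'm) category_data =
  Obj :: "'o set"
  Arr :: "'m set"
  Dom :: "'m \<Rightarrow> 'o"
  Cod :: "'m \<Rightarrow> 'o"
  Id :: "'o \<Rightarrow> 'm"
  Comp :: "'m \<Rightarrow> 'm \<Rightarrow> 'm"  (infixr "\<cdot>\<index>" 55)

record ('o, 'm) monoidal_data = "('o, 'm) category_data" +
  TensorO :: "'o \<Rightarrow> 'o \<Rightarrow> 'o"  (infixr "\<otimes>\<index>" 70)
  TensorA :: "'m \<Rightarrow> 'm \<Rightarrow> 'm"  (infixr "\<odot>\<index>" 70)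
  UnitO :: "'o"
  Assoc :: "'o \<Rightarrow> 'o \<Rightarrow> 'o \<Rightarrow> 'm"
  LUnit :: "'o \<Rightarrow> 'm"
  RUnit :: "'o \<Rightarrow> 'm"

record ('o, 'm) braided_data = "('o, 'm) monoidal_data" +
  Braid :: "'o \<Rightarrow> 'o \<Rightarrow> 'm"

definition Hom :: "('o, 'm, 'x) category_data_scheme \<Rightarrow> 'o \<Rightarrow> 'o \<Rightarrow> 'm set" where
  "Hom C A B = {f \<in> Arr C. Dom C f = A \<and> Cod C f = B}"

definition inverse_arrows :: "('o, 'm, 'x) category_data_scheme \<Rightarrow> 'm \<Rightarrow> 'm \<Rightarrow> bool" where
  "inverse_arrows C f g \<longleftrightarrow>
     f \<in> Arr C \<and> g \<in> Hom C (Cod C f) (Dom C f) \<and>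
     Comp C g f = Id C (Dom C f) \<and> Comp C f g = Id C (Cod C f)"

definition iso_arrow :: "('o, 'm, 'x) category_data_scheme \<Rightarrow> 'm \<Rightarrow> bool" where
  "iso_arrow C f \<longleftrightarrow> (\<exists>g. inverse_arrows C f g)"

definition inv_arrow :: "('o, 'm, 'x) category_data_scheme \<Rightarrow> 'm \<Rightarrow> 'm" where
  "inv_arrow C f = (THE g. inverse_arrows C f g)"

locale category =
  fixes C :: "('o, 'm, 'x) category_data_scheme" (structure)
  assumes dom_obj: "f \<in> Arr C \<Longrightarrow> Dom C f \<in> Obj C"
    and cod_obj: "f \<in> Arr C \<Longrightarrow> Cod C f \<in> Obj C"
    and id_hom: "A \<in> Obj C \<Longrightarrow> Id C A \<in> Hom C A A"
    and comp_hom: "\<lbrakk>f \<in> Hom C A B; g \<in> Hom C B D\<rbrakk> \<Longrightarrow> g \<cdot> f \<in> Hom C A D"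
    and id_left: "f \<in> Hom C A B \<Longrightarrow> Id C B \<cdot> f = f"
    and id_right: "f \<in> Hom C A B \<Longrightarrow> f \<cdot> Id C A = f"
    and comp_assoc: "\<lbrakk>f \<in> Hom C A B; g \<in> Hom C B D; h \<in> Hom C D E\<rbrakk>
           \<Longrightarrow> (h \<cdot> g) \<cdot> f = h \<cdot> (g \<cdot> f)"

locale monoidal_category = category C
  for C :: "('o, 'm, 'x) monoidal_data_scheme" (structure) +
  assumes tensor_obj: "\<lbrakk>A \<in> Obj C; B \<in> Obj C\<rbrakk> \<Longrightarrow> A \<otimes> B \<in> Obj C"
    and tensor_hom: "\<lbrakk>f \<in> Hom C A A'; g \<in> Hom C B B'\<rbrakk>
           \<Longrightarrow> f \<odot> g \<in> Hom C (A \<otimes> B) (A' \<otimes> B')"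
    and tensor_id: "\<lbrakk>A \<in> Obj C; B \<in> Obj C\<rbrakk> \<Longrightarrow> Id C A \<odot> Id C B = Id C (A \<otimes> B)"
    and tensor_comp: "\<lbrakk>f \<in> Hom C A A'; f' \<in> Hom C A' A''; g \<in> Hom C B B'; g' \<in> Hom C B' B''\<rbrakk>
           \<Longrightarrow> (f' \<cdot> f) \<odot> (g' \<cdot> g) = (f' \<odot> g') \<cdot> (f \<odot> g)"
    and unit_obj: "UnitO C \<in> Obj C"
    and assoc_hom: "\<lbrakk>A \<in> Obj C; B \<in> Obj C; D \<in> Obj C\<rbrakk>
           \<Longrightarrow> Assoc C A B D \<in> Hom C ((A \<otimes> B) \<otimes> D) (A \<otimes> (B \<otimes> D))"
    and assoc_iso: "\<lbrakk>A \<in> Obj C; B \<in> Obj C; D \<in> Obj C\<rbrakk> \<Longrightarrow> iso_arrow C (Assoc C A B D)"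
    and assoc_natural: "\<lbrakk>f \<in> Hom C A A'; g \<in> Hom C B B'; h \<in> Hom C D D'\<rbrakk>
           \<Longrightarrow> Assoc C A' B' D' \<cdot> ((f \<odot> g) \<odot> h) = (f \<odot> (g \<odot> h)) \<cdot> Assoc C A B D"
    and lunit_hom: "A \<in> Obj C \<Longrightarrow> LUnit C A \<in> Hom C (UnitO C \<otimes> A) A"
    and lunit_iso: "A \<in> Obj C \<Longrightarrow> iso_arrow C (LUnit C A)"
    and lunit_natural: "f \<in> Hom C A A' \<Longrightarrow> LUnit C A' \<cdot> (Id C (UnitO C) \<odot> f) = f \<cdot> LUnit C A"
    and runit_hom: "A \<in> Obj C \<Longrightarrow> RUnit C A \<in> Hom C (A \<otimes> UnitO C) A"
    and runit_iso: "A \<in> Obj C \<Longrightarrow> iso_arrow C (RUnit C A)"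
    and runit_natural: "f \<in> Hom C A A' \<Longrightarrow> RUnit C A' \<cdot> (f \<odot> Id C (UnitO C)) = f \<cdot> RUnit C A"
    and pentagon: "\<lbrakk>A \<in> Obj C; B \<in> Obj C; D \<in> Obj C; E \<in> Obj C\<rbrakk>
           \<Longrightarrow> (Id C A \<odot> Assoc C B D E) \<cdot> Assoc C A (B \<otimes> D) E \<cdot> (Assoc C A B D \<odot> Id C E)
             = Assoc C A B (D \<otimes> E) \<cdot> Assoc C (A \<otimes> B) D E"
    and triangle: "\<lbrakk>A \<in> Obj C; B \<in> Obj C\<rbrakk>
           \<Longrightarrow> (Id C A \<odot> LUnit C B) \<cdot> Assoc C A (UnitO C) B = RUnit C A \<odot> Id C B"

locale braided_monoidal_category = monoidal_category C
  for C :: "('o, 'm, 'x) braided_data_scheme" (structure) +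
  assumes braid_hom: "\<lbrakk>A \<in> Obj C; B \<in> Obj C\<rbrakk> \<Longrightarrow> Braid C A B \<in> Hom C (A \<otimes> B) (B \<otimes> A)"
    and braid_iso: "\<lbrakk>A \<in> Obj C; B \<in> Obj C\<rbrakk> \<Longrightarrow> iso_arrow C (Braid C A B)"
    and braid_natural: "\<lbrakk>f \<in> Hom C A A'; g \<in> Hom C B B'\<rbrakk>
           \<Longrightarrow> Braid C A' B' \<cdot> (f \<odot> g) = (g \<odot> f) \<cdot> Braid C A B"
    and hexagon1: "\<lbrakk>A \<in> Obj C; B \<in> Obj C; D \<in> Obj C\<rbrakk>
           \<Longrightarrow> Assoc C B D A \<cdot> Braid C A (B \<otimes> D) \<cdot> Assoc C A B D
             = (Id C B \<odot> Braid C A D) \<cdot> Assoc C B A D \<cdot> (Braid C A B \<odot> Id C D)"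
    and hexagon2: "\<lbrakk>A \<in> Obj C; B \<in> Obj C; D \<in> Obj C\<rbrakk>
           \<Longrightarrow> inv_arrow C (Assoc C D A B) \<cdot> Braid C (A \<otimes> B) D \<cdot> inv_arrow C (Assoc C A B D)
             = (Braid C A D \<odot> Id C B) \<cdot> inv_arrow C (Assoc C A D B) \<cdot> (Id C A \<odot> Braid C B D)"

locale symmetric_monoidal_category = braided_monoidal_category C
  for C :: "('o, 'm, 'x) braided_data_scheme" (structure) +
  assumes braid_inverse: "\<lbrakk>A \<in> Obj C; B \<in> Obj C\<rbrakk>
           \<Longrightarrow> inverse_arrows C (Braid C A B) (Braid C B A)"


section \<open>Generalized rings and centrally graded sets\<close>

text \<open>The abelian group \<open>\<Gamma>\<close> is the type \<open>'g\<close>.\<close>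

locale generalized_ring =
  fixes mult :: "'g::ab_group_add \<Rightarrow> 'g \<Rightarrow> 'g"
  assumes add_left: "mult (a + b) c = mult a c + mult b c"
    and add_right: "mult a (b + c) = mult a b + mult a c"

definition skew :: "('g::ab_group_add \<Rightarrow> 'g \<Rightarrow> 'g) \<Rightarrow> bool" where
  "skew mult \<longleftrightarrow> (\<forall>a b. mult a b + mult b a = 0)"

record ('g, 'a) graded_set =
  carrier :: "'a set"
  deg :: "'a \<Rightarrow> 'g"
  act :: "'g \<Rightarrow> 'a \<Rightarrow> 'a"

definition centrally_graded :: "('g::ab_group_add, 'a) graded_set \<Rightarrow> bool" where
  "centrally_graded M \<longleftrightarrow>
     (\<forall>m \<in> carrier M.
        act M 0 m = m \<and>
        (\<forall>x. act M x m \<in> carrier M \<and> deg M (act M x m) = deg M m) \<and>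
        (\<forall>x y. act M (x + y) m = act M x (act M y m)))"

definition graded_hom ::
  "('g, 'a) graded_set \<Rightarrow> ('g, 'b) graded_set \<Rightarrow> ('a \<Rightarrow> 'b) set" where
  "graded_hom M N =
     {f \<in> carrier M \<rightarrow>\<^sub>E carrier N.
        \<forall>m \<in> carrier M. deg N (f m) = deg M m \<and> (\<forall>x. f (act M x m) = act N x (f m))}"

definition graded_inverse ::
  "('g, 'a) graded_set \<Rightarrow> ('g, 'b) graded_set \<Rightarrow> ('a \<Rightarrow> 'b) \<Rightarrow> ('b \<Rightarrow> 'a) \<Rightarrow> bool" where
  "graded_inverse M N f g \<longleftrightarrow>
     f \<in> graded_hom M N \<and> g \<in> graded_hom N M \<and>
     (\<forall>m \<in> carrier M. g (f m) = m) \<and> (\<forall>n \<in> carrier N. f (g n) = n)"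

definition graded_iso ::
  "('g, 'a) graded_set \<Rightarrow> ('g, 'b) graded_set \<Rightarrow> ('a \<Rightarrow> 'b) \<Rightarrow> bool" where
  "graded_iso M N f \<longleftrightarrow> (\<exists>g. graded_inverse M N f g)"


section \<open>The product\<close>

definition zrel ::
  "('g, 'a) graded_set \<Rightarrow> ('g, 'b) graded_set \<Rightarrow> (('a \<times> 'b) \<times> ('a \<times> 'b)) set" where
  "zrel M N = {((act M x m, n), (m, act N x n)) | x m n. m \<in> carrier M \<and> n \<in> carrier N}"

text \<open>The relation is already an equivalence, so no closure is needed to form the quotient.\<close>

lemma equiv_zrel:
  assumes "centrally_graded M" "centrally_graded N"
  shows "equiv (carrier M \<times> carrier N) (zrel M N)"
proof (rule equivI)
  show "zrel M N \<subseteq> (carrier M \<times> carrier N) \<times> (carrier M \<times> carrier N)"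
    using assms by (auto simp: zrel_def centrally_graded_def)
  show "refl_on (carrier M \<times> carrier N) (zrel M N)"
  proof (rule refl_onI)
    fix p assume "p \<in> carrier M \<times> carrier N"
    then obtain m n where "p = (m, n)" "m \<in> carrier M" "n \<in> carrier N" by auto
    moreover have "act M 0 m = m" "act N 0 n = n"
      using assms calculation by (auto simp: centrally_graded_def)
    ultimately show "(p, p) \<in> zrel M N"
      unfolding zrel_def by (auto intro!: exI[of _ 0])
  qed
  show "sym (zrel M N)"
  proof (rule symI)
    fix p q assume "(p, q) \<in> zrel M N"
    then obtain x m n where pq: "p = (act M x m, n)" "q = (m, act N x n)"
      and mn: "m \<in> carrier M" "n \<in> carrier N" by (auto simp: zrel_def)
    have "act M (- x + x) m = act M (- x) (act M x m)" "act N (- x + x) n = act N (- x) (act N x n)"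
      using assms mn unfolding centrally_graded_def by blast+
    then have "act M (- x) (act M x m) = m" "act N (- x) (act N x n) = n"
      using assms mn by (auto simp: centrally_graded_def)
    then have "q = (act M (- x) (act M x m), act N x n)" "p = (act M x m, act N (- x) (act N x n))"
      using pq by auto
    moreover have "act M x m \<in> carrier M" "act N x n \<in> carrier N"
      using assms mn by (auto simp: centrally_graded_def)
    ultimately show "(q, p) \<in> zrel M N"
      unfolding zrel_def by blast
  qed
  show "trans (zrel M N)"
  proof (rule transI)
    fix p q r assume "(p, q) \<in> zrel M N" "(q, r) \<in> zrel M N"
    then obtain x m n y m' n' where pq: "p = (act M x m, n)" "q = (m, act N x n)"
      and qr: "q = (act M y m', n')" "r = (m', act N y n')"
      and mn: "m \<in> carrier M" "n \<in> carrier N" "m' \<in> carrier M" "n' \<in> carrier N"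
      unfolding zrel_def by blast
    have "act M (x + y) m' = act M x (act M y m')" "act N (y + x) n = act N y (act N x n)"
      using assms mn unfolding centrally_graded_def by blast+
    then have "p = (act M (x + y) m', n)" "r = (m', act N (x + y) n)"
      using pq qr by (auto simp: add.commute)
    then show "(p, r) \<in> zrel M N"
      unfolding zrel_def using mn by blast
  qed
qed

text \<open>
  Throughout, \<open>enc\<close> is an injective coding of equivalence classes. For \<open>enc = id\<close> one obtains
  the quotient set itself. A general \<open>enc\<close> allows the product of two sets with elements in a
  type \<open>'u\<close> to have elements in \<open>'u\<close> again, which is needed in order to have one type of
  objects of the category.
\<close>

definition zclass ::
  "(('a \<times> 'b) set \<Rightarrow> 'c) \<Rightarrow> ('g, 'a) graded_set \<Rightarrow> ('g, 'b) graded_set \<Rightarrow> 'a \<Rightarrow> 'b \<Rightarrow> 'c" where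
  "zclass enc M N m n = enc (zrel M N `` {(m, n)})"

text \<open>
  \<open>zlift enc M N h\<close> is the function \<open>[m, n] \<mapsto> h m n\<close>; its value is the common value of \<open>h\<close>
  on all representatives, and is unspecified if there is no such common value.
\<close>

definition zlift ::
  "(('a \<times> 'b) set \<Rightarrow> 'c) \<Rightarrow> ('g, 'a) graded_set \<Rightarrow> ('g, 'b) graded_set
     \<Rightarrow> ('a \<Rightarrow> 'b \<Rightarrow> 'd) \<Rightarrow> 'c \<Rightarrow> 'd" where
  "zlift enc M N h u =
     the_elem {h m n | m n. m \<in> carrier M \<and> n \<in> carrier N \<and> zclass enc M N m n = u}"

definition zprod ::
  "(('a \<times> 'b) set \<Rightarrow> 'c) \<Rightarrow> ('g::ab_group_add, 'a) graded_set \<Rightarrow> ('g, 'b) graded_set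
     \<Rightarrow> ('g, 'c) graded_set" where
  "zprod enc M N =
     \<lparr> carrier = enc ` ((carrier M \<times> carrier N) // zrel M N),
       deg = zlift enc M N (\<lambda>m n. deg M m + deg N n),
       act = (\<lambda>x. zlift enc M N (\<lambda>m n. zclass enc M N (act M x m) n)) \<rparr>"

definition zmap ::
  "(('a \<times> 'b) set \<Rightarrow> 'c) \<Rightarrow> (('d \<times> 'e) set \<Rightarrow> 'f)
     \<Rightarrow> ('g::ab_group_add, 'a) graded_set \<Rightarrow> ('g, 'b) graded_set
     \<Rightarrow> ('g, 'd) graded_set \<Rightarrow> ('g, 'e) graded_set
     \<Rightarrow> ('a \<Rightarrow> 'd) \<Rightarrow> ('b \<Rightarrow> 'e) \<Rightarrow> 'c \<Rightarrow> 'f" where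
  "zmap enc enc' M1 M2 N1 N2 f1 f2 =
     restrict (zlift enc M1 M2 (\<lambda>m1 m2. zclass enc' N1 N2 (f1 m1) (f2 m2)))
       (carrier (zprod enc M1 M2))"

definition braiding ::
  "(('a \<times> 'b) set \<Rightarrow> 'c) \<Rightarrow> (('b \<times> 'a) set \<Rightarrow> 'd) \<Rightarrow> ('g::ab_group_add \<Rightarrow> 'g \<Rightarrow> 'g)
     \<Rightarrow> ('g, 'a) graded_set \<Rightarrow> ('g, 'b) graded_set \<Rightarrow> 'c \<Rightarrow> 'd" where
  "braiding enc enc' mult M1 M2 =
     restrict
       (zlift enc M1 M2
          (\<lambda>x1 x2. act (zprod enc' M2 M1) (mult (deg M2 x2) (deg M1 x1)) (zclass enc' M2 M1 x2 x1)))
       (carrier (zprod enc M1 M2))"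


section \<open>The category of centrally graded sets in a universe\<close>

text \<open>
  Since the objects of a category must have a common type, the category consists of the
  centrally graded sets with elements in a universe type \<open>'u\<close>. A universe contains a copy of
  \<open>\<Gamma>\<close>, for the unit object, and a code for each set of pairs of its elements indexed by
  \<open>\<Gamma>\<close>; the classes \<open>[m, n]\<close> are such sets. Universes exist, and any set embeds into
  one of them: see \<open>universe_exists\<close>.
\<close>

locale graded_universe =
  fixes enc :: "('u \<times> 'u) set \<Rightarrow> 'u"
    and scal :: "'g::ab_group_add \<Rightarrow> 'u"
  assumes inj_scal: "inj scal"
    and inj_enc: "inj_on enc {range f | f :: 'g \<Rightarrow> 'u \<times> 'u. True}"

lemma universe_exists:
  "\<exists>(enc :: (((('g \<times> bool) list \<Rightarrow> 'a option) \<times> (('g \<times> bool) list \<Rightarrow> 'a option)) set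
                \<Rightarrow> (('g \<times> bool) list \<Rightarrow> 'a option)))
      (scal :: 'g::ab_group_add \<Rightarrow> (('g \<times> bool) list \<Rightarrow> 'a option))
      (emb :: 'a \<Rightarrow> (('g \<times> bool) list \<Rightarrow> 'a option)).
     graded_universe enc scal \<and> inj emb"
proof -
  let ?scal = "\<lambda>x l. if l = [(x :: 'g, True)] then Some undefined else (None :: 'a option)"
  define code where "code = (\<lambda>(F :: 'g \<Rightarrow> (('g \<times> bool) list \<Rightarrow> 'a option) \<times> (('g \<times> bool) list \<Rightarrow> 'a option)) l.
      case l of [] \<Rightarrow> None | p # k \<Rightarrow> (if snd p then fst (F (fst p)) k else snd (F (fst p)) k))"
  have inj_code: "inj code"
  proof (rule injI, rule ext)
    fix F G x assume eq: "code F = code G"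
    have "fst (F x) k = fst (G x) k" "snd (F x) k = snd (G x) k" for k
      using fun_cong[OF eq, of "(x, True) # k"] fun_cong[OF eq, of "(x, False) # k"]
      by (simp_all add: code_def)
    then show "F x = G x" by (simp add: prod_eq_iff fun_eq_iff)
  qed
  define enc where "enc = (\<lambda>A. code (SOME F. range F = A))"
  have range_some: "range (SOME F :: 'g \<Rightarrow> _. range F = range f) = range f"
    for f :: "'g \<Rightarrow> (('g \<times> bool) list \<Rightarrow> 'a option) \<times> (('g \<times> bool) list \<Rightarrow> 'a option)"
    by (rule someI[where P = "\<lambda>F. range F = range f" and x = f]) (rule refl)
  have "inj_on enc {range f | f :: 'g \<Rightarrow> _. True}"
  proof (rule inj_onI)
    fix A B assume "A \<in> {range f | f :: 'g \<Rightarrow> _. True}" "B \<in> {range f | f :: 'g \<Rightarrow> _. True}"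
      and eq: "enc A = enc B"
    then obtain f g :: "'g \<Rightarrow> _" where fg: "A = range f" "B = range g" by blast
    have "(SOME F :: 'g \<Rightarrow> _. range F = range f) = (SOME F. range F = range g)"
      using eq unfolding enc_def fg by (rule injD[OF inj_code])
    then have "range (SOME F :: 'g \<Rightarrow> _. range F = range f) = range (SOME F :: 'g \<Rightarrow> _. range F = range g)"
      by (rule arg_cong)
    then show "A = B" unfolding range_some fg .
  qed
  moreover have "inj ?scal"
  proof (rule injI)
    fix x y assume "?scal x = ?scal y"
    from fun_cong[OF this, of "[(x, True)]"] show "x = y" by (simp split: if_splits)
  qed
  ultimately have "graded_universe enc ?scal" by (rule graded_universe.intro[rotated])
  moreover have "inj (\<lambda>(a :: 'a) (l :: ('g \<times> bool) list). Some a)"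
    by (rule injI) (simp add: fun_eq_iff)
  ultimately show ?thesis by (intro exI conjI)
qed

definition zunit :: "('g::ab_group_add \<Rightarrow> 'u) \<Rightarrow> ('g, 'u) graded_set" where
  "zunit scal =
     \<lparr> carrier = range scal, deg = (\<lambda>u. 0), act = (\<lambda>x u. scal (x + inv scal u)) \<rparr>"

definition zassoc ::
  "(('u \<times> 'u) set \<Rightarrow> 'u) \<Rightarrow> ('g::ab_group_add, 'u) graded_set \<Rightarrow> ('g, 'u) graded_set
     \<Rightarrow> ('g, 'u) graded_set \<Rightarrow> 'u \<Rightarrow> 'u" where
  "zassoc enc M1 M2 M3 =
     restrict
       (zlift enc (zprod enc M1 M2) M3
          (\<lambda>p m3. zlift enc M1 M2
             (\<lambda>m1 m2. zclass enc M1 (zprod enc M2 M3) m1 (zclass enc M2 M3 m2 m3)) p))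
       (carrier (zprod enc (zprod enc M1 M2) M3))"

definition zlunit ::
  "(('u \<times> 'u) set \<Rightarrow> 'u) \<Rightarrow> ('g::ab_group_add \<Rightarrow> 'u) \<Rightarrow> ('g, 'u) graded_set \<Rightarrow> 'u \<Rightarrow> 'u" where
  "zlunit enc scal M =
     restrict (zlift enc (zunit scal) M (\<lambda>u m. act M (inv scal u) m))
       (carrier (zprod enc (zunit scal) M))"

definition zrunit ::
  "(('u \<times> 'u) set \<Rightarrow> 'u) \<Rightarrow> ('g::ab_group_add \<Rightarrow> 'u) \<Rightarrow> ('g, 'u) graded_set \<Rightarrow> 'u \<Rightarrow> 'u" where
  "zrunit enc scal M =
     restrict (zlift enc M (zunit scal) (\<lambda>m u. act M (inv scal u) m))
       (carrier (zprod enc M (zunit scal)))"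

record ('g, 'u) graded_arrow =
  source :: "('g, 'u) graded_set"
  app :: "'u \<Rightarrow> 'u"
  target :: "('g, 'u) graded_set"

definition graded_category ::
  "(('u \<times> 'u) set \<Rightarrow> 'u) \<Rightarrow> ('g::ab_group_add \<Rightarrow> 'u) \<Rightarrow> ('g \<Rightarrow> 'g \<Rightarrow> 'g)
     \<Rightarrow> (('g, 'u) graded_set, ('g, 'u) graded_arrow) braided_data" where
  "graded_category enc scal mult =
     \<lparr> Obj = {M. centrally_graded M},
       Arr = {f. centrally_graded (source f) \<and> centrally_graded (target f) \<and>
                 app f \<in> graded_hom (source f) (target f)},
       Dom = source,
       Cod = target,
       Id = (\<lambda>M. \<lparr> source = M, app = restrict id (carrier M), target = M \<rparr>),
       Comp = (\<lambda>g f. \<lparr> source = source f,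
                       app = compose (carrier (source f)) (app g) (app f),
                       target = target g \<rparr>),
       TensorO = zprod enc,
       TensorA = (\<lambda>f1 f2. \<lparr> source = zprod enc (source f1) (source f2),
                            app = zmap enc enc (source f1) (source f2) (target f1) (target f2)
                                    (app f1) (app f2),
                            target = zprod enc (target f1) (target f2) \<rparr>),
       UnitO = zunit scal,
       Assoc = (\<lambda>M1 M2 M3. \<lparr> source = zprod enc (zprod enc M1 M2) M3,
                              app = zassoc enc M1 M2 M3,
                              target = zprod enc M1 (zprod enc M2 M3) \<rparr>),
       LUnit = (\<lambda>M. \<lparr> source = zprod enc (zunit scal) M, app = zlunit enc scal M, target = M \<rparr>),
       RUnit = (\<lambda>M. \<lparr> source = zprod enc M (zunit scal), app = zrunit enc scal M, target = M \<rparr>),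
       Braid = (\<lambda>M1 M2. \<lparr> source = zprod enc M1 M2,
                           app = braiding enc enc mult M1 M2,
                           target = zprod enc M2 M1 \<rparr>) \<rparr>"

text \<open>
  Strictness: the associators are the identifications \<open>[[m1, m2], m3] = [m1, [m2, m3]]\<close> induced
  by \<open>(M1 \<times> M2) \<times> M3 = M1 \<times> (M2 \<times> M3)\<close>. Under these identifications the hexagons are
  the two triangles that express a braiding of a strictly associative product.
\<close>

definition strict_associators ::
  "(('u \<times> 'u) set \<Rightarrow> 'u)
     \<Rightarrow> (('g::ab_group_add, 'u) graded_set, ('g, 'u) graded_arrow, 'x) monoidal_data_scheme
     \<Rightarrow> bool" where
  "strict_associators enc C \<longleftrightarrow>
     (\<forall>M1 \<in> Obj C. \<forall>M2 \<in> Obj C. \<forall>M3 \<in> Obj C.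
        \<forall>m1 \<in> carrier M1. \<forall>m2 \<in> carrier M2. \<forall>m3 \<in> carrier M3.
          app (Assoc C M1 M2 M3)
              (zclass enc (TensorO C M1 M2) M3 (zclass enc M1 M2 m1 m2) m3)
            = zclass enc M1 (TensorO C M2 M3) m1 (zclass enc M2 M3 m2 m3))"

end

theory Submission
  imports Defs
begin

text \<open>
  Every structure map is a map out of a product, induced by a biequivariant map on pairs of
  representatives, so all coherence laws can be checked on representatives. There one may pull
  every \<open>\<Gamma>\<close>-action out of the classes; both sides of an axiom then become the same class,
  acted upon by an element of \<open>\<Gamma>\<close>, and these elements agree by biadditivity.
  Well-definedness and invertibility of the braiding do not use biadditivity: the inverse of the
  braiding for a product \<open>ab\<close> is the braiding for the product \<open>- ba\<close>.
\<close>

section \<open>Centrally graded sets\<close>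

text \<open>The last equation merges nested actions into a single one, so that comparing two shifts
  of the same class reduces to an identity in \<Gamma>.\<close>

lemma centrally_gradedD [simp]:
  assumes "centrally_graded M" "m \<in> carrier M"
  shows "act M 0 m = m" "act M x m \<in> carrier M" "deg M (act M x m) = deg M m"
    "act M x (act M y m) = act M (x + y) m"
  using assms unfolding centrally_graded_def by metis+

lemma graded_homD:
  assumes "f \<in> graded_hom M N" "m \<in> carrier M"
  shows "f m \<in> carrier N" "deg N (f m) = deg M m" "f (act M x m) = act N x (f m)"
  using assms unfolding graded_hom_def by auto

lemma graded_hom_extensional: "f \<in> graded_hom M N \<Longrightarrow> f \<in> extensional (carrier M)"
  unfolding graded_hom_def PiE_def by blast

lemma graded_hom_id: "centrally_graded M \<Longrightarrow> restrict id (carrier M) \<in> graded_hom M M"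
  unfolding graded_hom_def by auto

lemma graded_hom_compose:
  assumes "centrally_graded M" "f \<in> graded_hom M N" "g \<in> graded_hom N P"
  shows "compose (carrier M) g f \<in> graded_hom M P"
  using assms unfolding graded_hom_def by (auto simp: compose_def Pi_iff PiE_iff)

section \<open>Products of centrally graded sets\<close>

text \<open>Injectivity is demanded only on the classes that occur. This covers both
  \<open>enc = id\<close>, where the two factors may have different element types, and the coding of
  a universe, which is injective only on sets indexed by \<Gamma>.\<close>

locale coded_pair =
  fixes enc :: "('a \<times> 'b) set \<Rightarrow> 'c"
    and M :: "('g::ab_group_add, 'a) graded_set"
    and N :: "('g, 'b) graded_set"
  assumes graded_left [simp]: "centrally_graded M"
    and graded_right [simp]: "centrally_graded N"
    and inj_on_classes: "inj_on enc ((carrier M \<times> carrier N) // zrel M N)"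
begin

lemma zclass_eq_iff:
  assumes "m \<in> carrier M" "n \<in> carrier N" "m' \<in> carrier M" "n' \<in> carrier N"
  shows "zclass enc M N m n = zclass enc M N m' n' \<longleftrightarrow> ((m, n), (m', n')) \<in> zrel M N"
proof -
  have "zrel M N `` {(m, n)} \<in> (carrier M \<times> carrier N) // zrel M N"
    "zrel M N `` {(m', n')} \<in> (carrier M \<times> carrier N) // zrel M N"
    using assms by (auto intro: quotientI)
  then show ?thesis
    unfolding zclass_def
    using inj_on_eq_iff[OF inj_on_classes] eq_equiv_class_iff[OF equiv_zrel[of M N]] assms
    by simp
qed

lemma zclass_act_left:
  assumes "m \<in> carrier M" "n \<in> carrier N"
  shows "zclass enc M N (act M x m) n = zclass enc M N m (act N x n)"
  using assms zclass_eq_iff[of "act M x m" n m "act N x n"] unfolding zrel_def by auto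

text \<open>Two representatives of a class differ by a single shift, because \<open>zrel\<close> is
  already an equivalence. A balanced \<open>h\<close> is therefore constant on the class, and the
  set in \<open>zlift\<close> is a singleton.\<close>

lemma zlift_zclass:
  assumes "\<And>x m n. m \<in> carrier M \<Longrightarrow> n \<in> carrier N \<Longrightarrow> h (act M x m) n = h m (act N x n)"
    and "m \<in> carrier M" "n \<in> carrier N"
  shows "zlift enc M N h (zclass enc M N m n) = h m n"
proof -
  have "{h m' n' | m' n'. m' \<in> carrier M \<and> n' \<in> carrier N \<and>
      zclass enc M N m' n' = zclass enc M N m n} = {h m n}"
  proof (intro equalityI subsetI)
    fix v assume "v \<in> {h m' n' | m' n'. m' \<in> carrier M \<and> n' \<in> carrier N \<and>
      zclass enc M N m' n' = zclass enc M N m n}"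
    then obtain m' n' where v: "v = h m' n'" "m' \<in> carrier M" "n' \<in> carrier N"
      and "zclass enc M N m' n' = zclass enc M N m n" by blast
    then have "((m', n'), (m, n)) \<in> zrel M N" using zclass_eq_iff assms by blast
    then obtain x k l where "k \<in> carrier M" "l \<in> carrier N"
      "m' = act M x k" "n' = l" "m = k" "n = act N x l"
      unfolding zrel_def by blast
    then show "v \<in> {h m n}" using v assms(1) by simp
  qed (use assms in blast)
  then show ?thesis unfolding zlift_def by simp
qed

lemma zprod_carrier:
  "carrier (zprod enc M N) = {zclass enc M N m n | m n. m \<in> carrier M \<and> n \<in> carrier N}"
  unfolding zprod_def zclass_def quotient_def by auto

lemma zclass_carrier [simp]:
  "m \<in> carrier M \<Longrightarrow> n \<in> carrier N \<Longrightarrow> zclass enc M N m n \<in> carrier (zprod enc M N)"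
  unfolding zprod_carrier by blast

lemma zprod_cases:
  assumes "p \<in> carrier (zprod enc M N)"
  obtains m n where "p = zclass enc M N m n" "m \<in> carrier M" "n \<in> carrier N"
  using assms unfolding zprod_carrier by blast

lemma zprod_deg [simp]:
  assumes "m \<in> carrier M" "n \<in> carrier N"
  shows "deg (zprod enc M N) (zclass enc M N m n) = deg M m + deg N n"
  using assms unfolding zprod_def by (simp add: zlift_zclass)

text \<open>Read from left to right, an action on either factor moves outside the class; this is the
  normal form of all later computations.\<close>

lemma zclass_act [simp]:
  assumes "m \<in> carrier M" "n \<in> carrier N"
  shows "zclass enc M N (act M x m) n = act (zprod enc M N) x (zclass enc M N m n)"
    and "zclass enc M N m (act N x n) = act (zprod enc M N) x (zclass enc M N m n)"
proof -
  have "act (zprod enc M N) x (zclass enc M N m n) = zclass enc M N (act M x m) n"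
    unfolding zprod_def using assms
    by (simp, subst zlift_zclass) (auto simp: zclass_act_left add.commute)
  then show "zclass enc M N (act M x m) n = act (zprod enc M N) x (zclass enc M N m n)"
    and "zclass enc M N m (act N x n) = act (zprod enc M N) x (zclass enc M N m n)"
    using assms by (simp_all add: zclass_act_left)
qed

lemma centrally_graded_zprod: "centrally_graded (zprod enc M N)"
  unfolding centrally_graded_def
proof (rule ballI)
  fix p assume "p \<in> carrier (zprod enc M N)"
  then obtain m n where p: "p = zclass enc M N m n" "m \<in> carrier M" "n \<in> carrier N"
    by (rule zprod_cases)
  \<comment> \<open>Here the normal form is reversed: the action is placed on the left factor, where
    the axioms of \<open>M\<close> apply.\<close>
  have act: "act (zprod enc M N) x (zclass enc M N k n) = zclass enc M N (act M x k) n"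
    if "k \<in> carrier M" for x k
    using p that by simp
  show "act (zprod enc M N) 0 p = p \<and>
      (\<forall>x. act (zprod enc M N) x p \<in> carrier (zprod enc M N) \<and>
        deg (zprod enc M N) (act (zprod enc M N) x p) = deg (zprod enc M N) p) \<and>
      (\<forall>x y. act (zprod enc M N) (x + y) p =
        act (zprod enc M N) x (act (zprod enc M N) y p))"
    using p by (simp add: act del: zclass_act)
qed

text \<open>Equivariance in each argument makes \<open>h\<close> balanced, since both sides of the
  balance condition become \<open>act P x (h m n)\<close>. Equivariance of the lift follows by
  shifting the left representative.\<close>

lemma zlift_hom:
  assumes "\<And>m n. m \<in> carrier M \<Longrightarrow> n \<in> carrier N \<Longrightarrow> h m n \<in> carrier P"
    and "\<And>m n. m \<in> carrier M \<Longrightarrow> n \<in> carrier N \<Longrightarrow> deg P (h m n) = deg M m + deg N n"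
    and "\<And>x m n. m \<in> carrier M \<Longrightarrow> n \<in> carrier N \<Longrightarrow> h (act M x m) n = act P x (h m n)"
    and "\<And>x m n. m \<in> carrier M \<Longrightarrow> n \<in> carrier N \<Longrightarrow> h m (act N x n) = act P x (h m n)"
  shows "restrict (zlift enc M N h) (carrier (zprod enc M N)) \<in> graded_hom (zprod enc M N) P"
proof -
  have lift: "zlift enc M N h (zclass enc M N m n) = h m n"
    if "m \<in> carrier M" "n \<in> carrier N" for m n
    using that assms by (intro zlift_zclass) auto
  have "zlift enc M N h p \<in> carrier P \<and> deg P (zlift enc M N h p) = deg (zprod enc M N) p \<and>
      (\<forall>x. zlift enc M N h (act (zprod enc M N) x p) = act P x (zlift enc M N h p))"
    if p: "p \<in> carrier (zprod enc M N)" for p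
  proof -
    from p obtain m n where mn: "p = zclass enc M N m n" "m \<in> carrier M" "n \<in> carrier N"
      by (rule zprod_cases)
    have "zlift enc M N h (act (zprod enc M N) x p) = act P x (zlift enc M N h p)" for x
      using lift[of "act M x m" n] mn assms lift by simp
    then show ?thesis using mn assms lift by simp
  qed
  then show ?thesis
    unfolding graded_hom_def using centrally_graded_zprod by simp
qed

text \<open>The set \<open>P\<close> enters only through the common value
  \<open>act P x (h m n)\<close> that makes \<open>h\<close> balanced.\<close>

lemma restrict_zlift_zclass:
  assumes "\<And>x m n. m \<in> carrier M \<Longrightarrow> n \<in> carrier N \<Longrightarrow> h (act M x m) n = act P x (h m n)"
    and "\<And>x m n. m \<in> carrier M \<Longrightarrow> n \<in> carrier N \<Longrightarrow> h m (act N x n) = act P x (h m n)"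
    and "m \<in> carrier M" "n \<in> carrier N"
  shows "restrict (zlift enc M N h) (carrier (zprod enc M N)) (zclass enc M N m n) = h m n"
  using assms by (simp add: zlift_zclass)

end

lemma coded_pair_id:
  "centrally_graded M \<Longrightarrow> centrally_graded N \<Longrightarrow> coded_pair id M N"
  by unfold_locales auto

section \<open>Products of morphisms\<close>

lemma zmap_hom:
  assumes "coded_pair enc M1 M2" "coded_pair enc' N1 N2"
    and f: "f1 \<in> graded_hom M1 N1" "f2 \<in> graded_hom M2 N2"
  shows "zmap enc enc' M1 M2 N1 N2 f1 f2 \<in> graded_hom (zprod enc M1 M2) (zprod enc' N1 N2)"
proof -
  interpret M: coded_pair enc M1 M2 by fact
  interpret N: coded_pair enc' N1 N2 by fact
  show ?thesis
    unfolding zmap_def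
    by (rule M.zlift_hom) (simp_all add: graded_homD[OF f(1)] graded_homD[OF f(2)])
qed

lemma zmap_extensional:
  "zmap enc enc' M1 M2 N1 N2 f1 f2 \<in> extensional (carrier (zprod enc M1 M2))"
  unfolding zmap_def by simp

lemma zmap_zclass:
  assumes "coded_pair enc M1 M2" "coded_pair enc' N1 N2"
    and f: "f1 \<in> graded_hom M1 N1" "f2 \<in> graded_hom M2 N2"
    and "m1 \<in> carrier M1" "m2 \<in> carrier M2"
  shows "zmap enc enc' M1 M2 N1 N2 f1 f2 (zclass enc M1 M2 m1 m2) = zclass enc' N1 N2 (f1 m1) (f2 m2)"
proof -
  interpret M: coded_pair enc M1 M2 by fact
  interpret N: coded_pair enc' N1 N2 by fact
  show ?thesis
    unfolding zmap_def
    by (rule M.restrict_zlift_zclass[where P = "zprod enc' N1 N2"])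
      (simp_all add: graded_homD[OF f(1)] graded_homD[OF f(2)] assms)
qed

section \<open>The braiding\<close>

text \<open>Shifting a representative leaves its degree, and hence the factor
  \<open>mult (deg M2 x2) (deg M1 x1)\<close>, unchanged. Commutativity of \<Gamma> lets the shift
  pass this factor and identifies the degrees of \<open>[x1, x2]\<close> and
  \<open>[x2, x1]\<close>.\<close>

lemma braiding_hom:
  assumes "coded_pair enc M1 M2" "coded_pair enc' M2 M1"
  shows "braiding enc enc' mult M1 M2 \<in> graded_hom (zprod enc M1 M2) (zprod enc' M2 M1)"
proof -
  interpret M: coded_pair enc M1 M2 by fact
  interpret N: coded_pair enc' M2 M1 by fact
  show ?thesis
    unfolding braiding_def
    by (rule M.zlift_hom) (simp_all add: N.centrally_graded_zprod ac_simps)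
qed

lemma braiding_zclass:
  assumes "coded_pair enc M1 M2" "coded_pair enc' M2 M1" "x1 \<in> carrier M1" "x2 \<in> carrier M2"
  shows "braiding enc enc' mult M1 M2 (zclass enc M1 M2 x1 x2) =
    act (zprod enc' M2 M1) (mult (deg M2 x2) (deg M1 x1)) (zclass enc' M2 M1 x2 x1)"
proof -
  interpret M: coded_pair enc M1 M2 by fact
  interpret N: coded_pair enc' M2 M1 by fact
  show ?thesis
    unfolding braiding_def
    by (rule M.restrict_zlift_zclass[where P = "zprod enc' M2 M1"])
      (simp_all add: N.centrally_graded_zprod ac_simps assms)
qed

text \<open>Well-definedness on representatives: two related pairs have the same degrees, and their
  swapped classes are the same shift of one class.\<close>

lemma braiding_respects:
  assumes "coded_pair enc M2 M1"
  shows "(\<lambda>(x1, x2). act (zprod enc M2 M1) (mult (deg M2 x2) (deg M1 x1)) (zclass enc M2 M1 x2 x1))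
    respects zrel M1 M2"
proof -
  interpret coded_pair enc M2 M1 by fact
  show ?thesis
    by (rule congruentI) (auto simp: zrel_def)
qed

text \<open>Applying both braidings in turn returns the original class, shifted by the sum of the
  two products of the degrees; \<open>opp\<close> says that this sum vanishes.\<close>

lemma braiding_inverse:
  assumes "coded_pair enc M1 M2" "coded_pair enc' M2 M1"
    and opp: "\<And>a b. mult' a b + mult b a = 0"
  shows "graded_inverse (zprod enc M1 M2) (zprod enc' M2 M1)
    (braiding enc enc' mult M1 M2) (braiding enc' enc mult' M2 M1)"
proof -
  interpret M: coded_pair enc M1 M2 by fact
  interpret N: coded_pair enc' M2 M1 by fact
  \<comment> \<open>The two composites produce the summands in opposite orders.\<close>
  have opp': "mult a b + mult' b a = 0" for a b using opp[of b a] by (simp add: add.commute)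
  note hom = braiding_hom[OF assms(1,2), of mult] braiding_hom[OF assms(2,1), of mult']
  note zclass = braiding_zclass[OF assms(1,2), of _ _ mult]
    braiding_zclass[OF assms(2,1), of _ _ mult']
  show ?thesis
    unfolding graded_inverse_def
    by (auto elim!: M.zprod_cases N.zprod_cases
        simp: hom zclass graded_homD(3)[OF hom(1)] graded_homD(3)[OF hom(2)] opp opp'
          M.centrally_graded_zprod N.centrally_graded_zprod)
qed

lemma braiding_inverse_uminus:
  assumes "coded_pair enc M1 M2" "coded_pair enc' M2 M1"
  shows "graded_inverse (zprod enc M1 M2) (zprod enc' M2 M1)
    (braiding enc enc' mult M1 M2) (braiding enc' enc (\<lambda>a b. - mult b a) M2 M1)"
  by (rule braiding_inverse[OF assms]) simp

section \<open>The monoidal structure\<close>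

context graded_universe
begin

text \<open>The class of \<open>(m, n)\<close> is the orbit of all \<open>(- x.m, x.n)\<close>,
  hence the range of a function on \<Gamma>, and on such ranges \<open>enc\<close> is
  injective.\<close>

lemma coded_pairI [intro, simp]:
  fixes M N :: "('g, 'u) graded_set"
  assumes [simp]: "centrally_graded M" "centrally_graded N"
  shows "coded_pair enc M N"
proof
  have "zrel M N `` {(m, n)} = range (\<lambda>x. (act M (- x) m, act N x n))"
    if "m \<in> carrier M" "n \<in> carrier N" for m n
  proof (intro equalityI subsetI)
    fix q assume "q \<in> zrel M N `` {(m, n)}"
    then obtain x k where "k \<in> carrier M" "m = act M x k" "q = (k, act N x n)"
      unfolding zrel_def by blast
    then have "q = (act M (- x) m, act N x n)" by simp
    then show "q \<in> range (\<lambda>x. (act M (- x) m, act N x n))" by blast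
  next
    fix q assume "q \<in> range (\<lambda>x. (act M (- x) m, act N x n))"
    then obtain x where q: "q = (act M (- x) m, act N x n)" by blast
    \<comment> \<open>This puts \<open>(m, n)\<close> into the shape \<open>(act M x k, n)\<close>
      required by \<open>zrel\<close>, with \<open>k = act M (- x) m\<close>.\<close>
    moreover have "m = act M x (act M (- x) m)" using that by simp
    moreover have "act M (- x) m \<in> carrier M" using that by simp
    ultimately show "q \<in> zrel M N `` {(m, n)}"
      using that(2) unfolding zrel_def Image_singleton by blast
  qed
  then have "(carrier M \<times> carrier N) // zrel M N \<subseteq> {range f | f :: 'g \<Rightarrow> 'u \<times> 'u. True}"
    unfolding quotient_def by blast
  then show "inj_on enc ((carrier M \<times> carrier N) // zrel M N)"
    using inj_enc inj_on_subset by blast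
qed fact+

declare coded_pair.zclass_carrier [simp] coded_pair.zprod_deg [simp] coded_pair.zclass_act [simp]
  zmap_hom [simp] zmap_extensional [simp] zmap_zclass [simp]
  braiding_hom [simp] braiding_zclass [simp] graded_hom_id [simp]

lemma zprod_graded [simp]:
  fixes M N :: "('g, 'u) graded_set"
  shows "centrally_graded M \<Longrightarrow> centrally_graded N \<Longrightarrow> centrally_graded (zprod enc M N)"
  by (simp add: coded_pair.centrally_graded_zprod)

lemma zprodE:
  fixes M N :: "('g, 'u) graded_set"
  assumes "p \<in> carrier (zprod enc M N)" "centrally_graded M" "centrally_graded N"
  obtains m n where "p = zclass enc M N m n" "m \<in> carrier M" "n \<in> carrier N"
  using coded_pair.zprod_cases[OF coded_pairI] assms by metis

lemma zlift_eval:
  fixes M N :: "('g, 'u) graded_set"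
  assumes "centrally_graded M" "centrally_graded N" "m \<in> carrier M" "n \<in> carrier N"
    and "\<And>x m n. m \<in> carrier M \<Longrightarrow> n \<in> carrier N \<Longrightarrow> h (act M x m) n = h m (act N x n)"
  shows "zlift enc M N h (zclass enc M N m n) = h m n"
  using coded_pair.zlift_zclass[OF coded_pairI] assms by metis

lemma inv_scal [simp]: "inv scal (scal x) = x"
  by (simp add: inj_scal)

lemma zunit_simps [simp]:
  "scal x \<in> carrier (zunit scal)" "deg (zunit scal) u = 0"
  "act (zunit scal) x (scal y) = scal (x + y)"
  by (simp_all add: zunit_def)

lemma zunitE:
  assumes "u \<in> carrier (zunit scal)"
  obtains x where "u = scal x"
  using assms by (auto simp: zunit_def)

lemma zunit_graded [simp]: "centrally_graded (zunit scal)"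
  by (auto simp: centrally_graded_def zunit_def ac_simps)

section \<open>The associator and its inverse\<close>

definition zassoc_inv ::
  "('g, 'u) graded_set \<Rightarrow> ('g, 'u) graded_set \<Rightarrow> ('g, 'u) graded_set \<Rightarrow> 'u \<Rightarrow> 'u" where
  "zassoc_inv M1 M2 M3 =
     restrict
       (zlift enc M1 (zprod enc M2 M3)
          (\<lambda>m1 p. zlift enc M2 M3
             (\<lambda>m2 m3. zclass enc (zprod enc M1 M2) M3 (zclass enc M1 M2 m1 m2) m3) p))
       (carrier (zprod enc M1 (zprod enc M2 M3)))"

context
  fixes M1 M2 M3 :: "('g, 'u) graded_set"
  assumes [simp]: "centrally_graded M1" "centrally_graded M2" "centrally_graded M3"
begin

text \<open>The associator is a lift inside a lift. The outer one can be evaluated only once the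
  inner one, for fixed \<open>m3\<close>, is known on classes and is equivariant in them.\<close>

lemma zassoc_inner:
  assumes "m1 \<in> carrier M1" "m2 \<in> carrier M2" "m3 \<in> carrier M3"
  shows "zlift enc M1 M2 (\<lambda>m1 m2. zclass enc M1 (zprod enc M2 M3) m1 (zclass enc M2 M3 m2 m3))
           (zclass enc M1 M2 m1 m2) = zclass enc M1 (zprod enc M2 M3) m1 (zclass enc M2 M3 m2 m3)"
    (is ?eval)
    and "zlift enc M1 M2 (\<lambda>m1 m2. zclass enc M1 (zprod enc M2 M3) m1 (zclass enc M2 M3 m2 m3))
           (act (zprod enc M1 M2) x (zclass enc M1 M2 m1 m2)) =
         act (zprod enc M1 (zprod enc M2 M3)) x
           (zclass enc M1 (zprod enc M2 M3) m1 (zclass enc M2 M3 m2 m3))"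
proof -
  \<comment> \<open>The element \<open>m1\<close> is kept arbitrary because a shift of the inner
    class is absorbed by its first factor.\<close>
  have eval: "zlift enc M1 M2 (\<lambda>m1 m2. zclass enc M1 (zprod enc M2 M3) m1 (zclass enc M2 M3 m2 m3))
           (zclass enc M1 M2 m1 m2) = zclass enc M1 (zprod enc M2 M3) m1 (zclass enc M2 M3 m2 m3)"
    if "m1 \<in> carrier M1" for m1
    by (rule zlift_eval) (use assms that in simp_all)
  show ?eval by (rule eval[OF assms(1)])
  show "zlift enc M1 M2 (\<lambda>m1 m2. zclass enc M1 (zprod enc M2 M3) m1 (zclass enc M2 M3 m2 m3))
           (act (zprod enc M1 M2) x (zclass enc M1 M2 m1 m2)) =
         act (zprod enc M1 (zprod enc M2 M3)) x
           (zclass enc M1 (zprod enc M2 M3) m1 (zclass enc M2 M3 m2 m3))"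
    using eval[of "act M1 x m1"] assms by simp
qed

lemma zassoc_inv_inner:
  assumes "m1 \<in> carrier M1" "m2 \<in> carrier M2" "m3 \<in> carrier M3"
  shows "zlift enc M2 M3 (\<lambda>m2 m3. zclass enc (zprod enc M1 M2) M3 (zclass enc M1 M2 m1 m2) m3)
           (zclass enc M2 M3 m2 m3) = zclass enc (zprod enc M1 M2) M3 (zclass enc M1 M2 m1 m2) m3"
    (is ?eval)
    and "zlift enc M2 M3 (\<lambda>m2 m3. zclass enc (zprod enc M1 M2) M3 (zclass enc M1 M2 m1 m2) m3)
           (act (zprod enc M2 M3) x (zclass enc M2 M3 m2 m3)) =
         act (zprod enc (zprod enc M1 M2) M3) x
           (zclass enc (zprod enc M1 M2) M3 (zclass enc M1 M2 m1 m2) m3)"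
proof -
  \<comment> \<open>Here the first factor of the inner class is \<open>m2\<close>, so this is the
    element that is kept arbitrary.\<close>
  have eval: "zlift enc M2 M3 (\<lambda>m2 m3. zclass enc (zprod enc M1 M2) M3 (zclass enc M1 M2 m1 m2) m3)
           (zclass enc M2 M3 m2 m3) = zclass enc (zprod enc M1 M2) M3 (zclass enc M1 M2 m1 m2) m3"
    if "m2 \<in> carrier M2" for m2
    by (rule zlift_eval) (use assms that in simp_all)
  show ?eval by (rule eval[OF assms(2)])
  show "zlift enc M2 M3 (\<lambda>m2 m3. zclass enc (zprod enc M1 M2) M3 (zclass enc M1 M2 m1 m2) m3)
           (act (zprod enc M2 M3) x (zclass enc M2 M3 m2 m3)) =
         act (zprod enc (zprod enc M1 M2) M3) x
           (zclass enc (zprod enc M1 M2) M3 (zclass enc M1 M2 m1 m2) m3)"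
    using eval[of "act M2 x m2"] assms by simp
qed

lemma zassoc_hom [simp]:
  "zassoc enc M1 M2 M3 \<in>
    graded_hom (zprod enc (zprod enc M1 M2) M3) (zprod enc M1 (zprod enc M2 M3))"
  unfolding zassoc_def
  by (rule coded_pair.zlift_hom) (auto elim!: zprodE simp: zassoc_inner ac_simps)

lemma zassoc_zclass [simp]:
  assumes "m1 \<in> carrier M1" "m2 \<in> carrier M2" "m3 \<in> carrier M3"
  shows "zassoc enc M1 M2 M3 (zclass enc (zprod enc M1 M2) M3 (zclass enc M1 M2 m1 m2) m3) =
    zclass enc M1 (zprod enc M2 M3) m1 (zclass enc M2 M3 m2 m3)"
  unfolding zassoc_def using assms
  by (subst coded_pair.restrict_zlift_zclass[where P = "zprod enc M1 (zprod enc M2 M3)"])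
    (auto elim!: zprodE simp: zassoc_inner)

lemma zassoc_inv_hom [simp]:
  "zassoc_inv M1 M2 M3 \<in>
    graded_hom (zprod enc M1 (zprod enc M2 M3)) (zprod enc (zprod enc M1 M2) M3)"
  unfolding zassoc_inv_def
  by (rule coded_pair.zlift_hom) (auto elim!: zprodE simp: zassoc_inv_inner ac_simps)

lemma zassoc_inv_zclass [simp]:
  assumes "m1 \<in> carrier M1" "m2 \<in> carrier M2" "m3 \<in> carrier M3"
  shows "zassoc_inv M1 M2 M3 (zclass enc M1 (zprod enc M2 M3) m1 (zclass enc M2 M3 m2 m3)) =
    zclass enc (zprod enc M1 M2) M3 (zclass enc M1 M2 m1 m2) m3"
  unfolding zassoc_inv_def using assms
  by (subst coded_pair.restrict_zlift_zclass[where P = "zprod enc (zprod enc M1 M2) M3"])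
    (auto elim!: zprodE simp: zassoc_inv_inner)

text \<open>The explicit inverse shows that the associator is an isomorphism and also identifies the
  \<open>inv_arrow\<close> terms of the second hexagon.\<close>

lemma zassoc_inverse:
  "graded_inverse (zprod enc (zprod enc M1 M2) M3) (zprod enc M1 (zprod enc M2 M3))
    (zassoc enc M1 M2 M3) (zassoc_inv M1 M2 M3)"
  unfolding graded_inverse_def by (auto elim!: zprodE)

end

section \<open>The unit isomorphisms\<close>

context
  fixes M :: "('g, 'u) graded_set"
  assumes [simp]: "centrally_graded M"
begin

lemma zlunit_hom [simp]: "zlunit enc scal M \<in> graded_hom (zprod enc (zunit scal) M) M"
  unfolding zlunit_def by (rule coded_pair.zlift_hom) (auto elim!: zunitE simp: ac_simps)

lemma zlunit_zclass [simp]: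
  "m \<in> carrier M \<Longrightarrow> zlunit enc scal M (zclass enc (zunit scal) M (scal x) m) = act M x m"
  unfolding zlunit_def
  by (subst coded_pair.restrict_zlift_zclass[where P = M]) (auto elim!: zunitE simp: ac_simps)

lemma zrunit_hom [simp]: "zrunit enc scal M \<in> graded_hom (zprod enc M (zunit scal)) M"
  unfolding zrunit_def by (rule coded_pair.zlift_hom) (auto elim!: zunitE simp: ac_simps)

lemma zrunit_zclass [simp]:
  "m \<in> carrier M \<Longrightarrow> zrunit enc scal M (zclass enc M (zunit scal) m (scal x)) = act M x m"
  unfolding zrunit_def
  by (subst coded_pair.restrict_zlift_zclass[where P = M]) (auto elim!: zunitE simp: ac_simps)

text \<open>The unit acts on itself by translation, so \<open>scal x\<close> is the shift of
  \<open>scal 0\<close> by \<open>x\<close>. This closes the round trip \<open>[x, m]\<close>,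
  \<open>x.m\<close>, \<open>[0, x.m] = x.[0, m] = [x, m]\<close>.\<close>

lemma act_zclass_scal:
  assumes "m \<in> carrier M"
  shows "act (zprod enc (zunit scal) M) x (zclass enc (zunit scal) M (scal 0) m) =
      zclass enc (zunit scal) M (scal x) m"
    and "act (zprod enc M (zunit scal)) x (zclass enc M (zunit scal) m (scal 0)) =
      zclass enc M (zunit scal) m (scal x)"
  using assms coded_pair.zclass_act(1)[of enc "zunit scal" M "scal 0" m x]
    coded_pair.zclass_act(2)[of enc M "zunit scal" m "scal 0" x] by simp_all

lemma zlunit_inverse:
  "graded_inverse (zprod enc (zunit scal) M) M (zlunit enc scal M)
    (\<lambda>m\<in>carrier M. zclass enc (zunit scal) M (scal 0) m)"
  \<comment> \<open>Only maps with source \<open>M\<close> have their morphism conditions unfolded,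
    that is, the inverse; its equivariance is \<open>[0, x.m] = x.[0, m]\<close>.\<close>
  unfolding graded_inverse_def graded_hom_def[of M]
  by (auto elim!: zprodE zunitE simp: act_zclass_scal(1))

lemma zrunit_inverse:
  "graded_inverse (zprod enc M (zunit scal)) M (zrunit enc scal M)
    (\<lambda>m\<in>carrier M. zclass enc M (zunit scal) m (scal 0))"
  unfolding graded_inverse_def graded_hom_def[of M]
  by (auto elim!: zprodE zunitE simp: act_zclass_scal(2))

end

section \<open>The braided category\<close>

abbreviation "graded_cat \<equiv> graded_category enc scal"

section \<open>Arrows as records, and their inverses\<close>

lemma graded_category_simps [simp]:
  "Obj (graded_cat mult) = {M. centrally_graded M}"
  "Dom (graded_cat mult) = source"
  "Cod (graded_cat mult) = target"
  "Id (graded_cat mult) M1 = \<lparr>source = M1, app = restrict id (carrier M1), target = M1\<rparr>"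
  "Comp (graded_cat mult) g f =
    \<lparr>source = source f, app = compose (carrier (source f)) (app g) (app f), target = target g\<rparr>"
  "TensorO (graded_cat mult) = zprod enc"
  "TensorA (graded_cat mult) f g =
    \<lparr>source = zprod enc (source f) (source g),
     app = zmap enc enc (source f) (source g) (target f) (target g) (app f) (app g),
     target = zprod enc (target f) (target g)\<rparr>"
  "UnitO (graded_cat mult) = zunit scal"
  "Assoc (graded_cat mult) M1 M2 M3 =
    \<lparr>source = zprod enc (zprod enc M1 M2) M3, app = zassoc enc M1 M2 M3,
     target = zprod enc M1 (zprod enc M2 M3)\<rparr>"
  "LUnit (graded_cat mult) M1 =
    \<lparr>source = zprod enc (zunit scal) M1, app = zlunit enc scal M1, target = M1\<rparr>"
  "RUnit (graded_cat mult) M1 =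
    \<lparr>source = zprod enc M1 (zunit scal), app = zrunit enc scal M1, target = M1\<rparr>"
  "Braid (graded_cat mult) M1 M2 =
    \<lparr>source = zprod enc M1 M2, app = braiding enc enc mult M1 M2, target = zprod enc M2 M1\<rparr>"
  by (simp_all add: graded_category_def)

lemma Hom_iff:
  "f \<in> Hom (graded_cat mult) A B \<longleftrightarrow> centrally_graded A \<and> centrally_graded B \<and>
    source f = A \<and> target f = B \<and> app f \<in> graded_hom A B"
  unfolding Hom_def graded_category_def by auto

text \<open>With arrows given as explicit records, both sides of a categorical law become records
  with the same source and target, as \<open>arrow_eqI\<close> expects.\<close>

lemma HomE:
  assumes "f \<in> Hom (graded_cat mult) A B"
  obtains \<phi> where "f = \<lparr>source = A, app = \<phi>, target = B\<rparr>"
    "centrally_graded A" "centrally_graded B" "\<phi> \<in> graded_hom A B"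
  using assms unfolding Hom_iff by (metis (full_types) graded_arrow.surjective old.unit.exhaust)

text \<open>Underlying maps take a default value outside the carrier, so agreement on the carrier
  determines the arrow.\<close>

lemma arrow_eqI:
  assumes "\<phi> \<in> extensional (carrier A)" "\<psi> \<in> extensional (carrier A)"
    and "\<And>x. x \<in> carrier A \<Longrightarrow> \<phi> x = \<psi> x"
  shows "\<lparr>source = A, app = \<phi>, target = B\<rparr> = \<lparr>source = A, app = \<psi>, target = B\<rparr>"
  using extensionalityI[OF assms] by simp

lemma inverse_arrowsI:
  assumes "centrally_graded A" "centrally_graded B" "graded_inverse A B \<phi> \<psi>"
  shows "inverse_arrows (graded_cat mult)
    \<lparr>source = A, app = \<phi>, target = B\<rparr> \<lparr>source = B, app = \<psi>, target = A\<rparr>"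
proof -
  have "compose (carrier A) \<psi> \<phi> = restrict id (carrier A)"
    "compose (carrier B) \<phi> \<psi> = restrict id (carrier B)"
    using assms(3) unfolding graded_inverse_def compose_def by auto
  moreover have "\<lparr>source = A, app = \<phi>, target = B\<rparr> \<in> Arr (graded_cat mult)"
    using assms unfolding graded_inverse_def by (simp add: graded_category_def)
  ultimately show ?thesis
    using assms unfolding inverse_arrows_def Hom_iff graded_inverse_def by simp
qed

section \<open>The category and monoidal axioms\<close>

lemma category_graded: "category (graded_cat mult)"
proof
  let ?C = "graded_cat mult"
  fix f g h A B D E
  assume "f \<in> Hom ?C A B" "g \<in> Hom ?C B D" "h \<in> Hom ?C D E"
  then show "(h \<cdot>\<^bsub>?C\<^esub> g) \<cdot>\<^bsub>?C\<^esub> f = h \<cdot>\<^bsub>?C\<^esub> (g \<cdot>\<^bsub>?C\<^esub> f)"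
    by (auto simp: Hom_iff graded_hom_def intro!: compose_assoc[symmetric])
next
  let ?C = "graded_cat mult"
  fix f A B
  assume "f \<in> Hom ?C A B"
  then obtain \<phi> where f: "f = \<lparr>source = A, app = \<phi>, target = B\<rparr>"
      and \<phi>: "\<phi> \<in> graded_hom A B"
    by (rule HomE)
  show "Id ?C B \<cdot>\<^bsub>?C\<^esub> f = f" "f \<cdot>\<^bsub>?C\<^esub> Id ?C A = f"
    unfolding f graded_category_simps graded_arrow.simps
    by (rule arrow_eqI; simp add: graded_homD(1)[OF \<phi>] graded_hom_extensional[OF \<phi>] compose_eq)+
qed (auto simp: Hom_iff graded_hom_compose, auto simp: graded_category_def)

text \<open>Since \<open>inv_arrow\<close> is a definite description, any inverse found explicitly
  must be shown to be the only one.\<close>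

lemma inv_arrowI:
  assumes "inverse_arrows (graded_cat mult) f g"
  shows "inv_arrow (graded_cat mult) f = g"
  unfolding inv_arrow_def
proof (rule the_equality)
  let ?C = "graded_cat mult"
  interpret category ?C by (rule category_graded)
  fix g' assume g': "inverse_arrows ?C f g'"
  have f: "f \<in> Hom ?C (source f) (target f)"
    using assms unfolding inverse_arrows_def Hom_def by simp
  have g: "g \<in> Hom ?C (target f) (source f)" "g' \<in> Hom ?C (target f) (source f)"
    using assms g' unfolding inverse_arrows_def by auto
  have inv: "g' \<cdot>\<^bsub>?C\<^esub> f = Id ?C (source f)" "f \<cdot>\<^bsub>?C\<^esub> g = Id ?C (target f)"
    using assms g' unfolding inverse_arrows_def graded_category_simps(2,3) by blast+
  show "g' = g"
    \<comment> \<open>The usual computation: \<open>g = (g' f) g = g' (f g) = g'\<close>.\<close>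
    using comp_assoc[OF g(1) f g(2)] id_left[OF g(1)] id_right[OF g(2)] unfolding inv by metis
qed fact

lemma monoidal_graded: "monoidal_category (graded_cat mult)"
proof -
  let ?C = "graded_cat mult"
  note [simp] = compose_eq
  interpret category ?C by (rule category_graded)
  show ?thesis
  proof
    fix f g A A' B B'
    assume "f \<in> Hom ?C A A'" "g \<in> Hom ?C B B'"
    then show "f \<odot>\<^bsub>?C\<^esub> g \<in> Hom ?C (A \<otimes>\<^bsub>?C\<^esub> B) (A' \<otimes>\<^bsub>?C\<^esub> B')"
      by (auto simp: Hom_iff)
  next
    fix A B
    assume "A \<in> Obj ?C" "B \<in> Obj ?C"
    then have [simp]: "centrally_graded A" "centrally_graded B" by simp_all
    show "Id ?C A \<odot>\<^bsub>?C\<^esub> Id ?C B = Id ?C (A \<otimes>\<^bsub>?C\<^esub> B)"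
      unfolding graded_category_simps graded_arrow.simps
      by (rule arrow_eqI) (auto elim!: zprodE)
    \<comment> \<open>On \<open>[[a, scal x], b]\<close> the left side shifts \<open>b\<close> by
      \<open>x\<close> and the right side shifts \<open>a\<close> by \<open>x\<close>; both give
      \<open>x.[a, b]\<close>.\<close>
    show "(Id ?C A \<odot>\<^bsub>?C\<^esub> LUnit ?C B) \<cdot>\<^bsub>?C\<^esub> Assoc ?C A (UnitO ?C) B = RUnit ?C A \<odot>\<^bsub>?C\<^esub> Id ?C B"
      unfolding graded_category_simps graded_arrow.simps
      by (rule arrow_eqI) (auto elim!: zprodE zunitE)
  next
    fix f f' g g' A A' A'' B B' B''
    assume "f \<in> Hom ?C A A'" "f' \<in> Hom ?C A' A''" "g \<in> Hom ?C B B'" "g' \<in> Hom ?C B' B''"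
    then obtain \<phi> \<phi>' \<gamma> \<gamma>' where eq: "f = \<lparr>source = A, app = \<phi>, target = A'\<rparr>"
        "f' = \<lparr>source = A', app = \<phi>', target = A''\<rparr>" "g = \<lparr>source = B, app = \<gamma>, target = B'\<rparr>"
        "g' = \<lparr>source = B', app = \<gamma>', target = B''\<rparr>"
      and [simp]: "centrally_graded A" "centrally_graded A'" "centrally_graded A''"
        "centrally_graded B" "centrally_graded B'" "centrally_graded B''"
      and hom: "\<phi> \<in> graded_hom A A'" "\<phi>' \<in> graded_hom A' A''" "\<gamma> \<in> graded_hom B B'"
        "\<gamma>' \<in> graded_hom B' B''"
      by (auto elim!: HomE)
    \<comment> \<open>The left side of the interchange law is \<open>zmap\<close> of two composites,
      so its value on classes requires these composites to be morphisms.\<close>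
    note [simp] = hom hom[THEN graded_homD(1)] graded_hom_compose[OF _ hom(1,2)]
      graded_hom_compose[OF _ hom(3,4)]
    show "(f' \<cdot>\<^bsub>?C\<^esub> f) \<odot>\<^bsub>?C\<^esub> (g' \<cdot>\<^bsub>?C\<^esub> g) = (f' \<odot>\<^bsub>?C\<^esub> g') \<cdot>\<^bsub>?C\<^esub> (f \<odot>\<^bsub>?C\<^esub> g)"
      unfolding eq graded_category_simps graded_arrow.simps
      by (rule arrow_eqI) (auto elim!: zprodE)
  next
    fix A B D
    assume "A \<in> Obj ?C" "B \<in> Obj ?C" "D \<in> Obj ?C"
    then have [simp]: "centrally_graded A" "centrally_graded B" "centrally_graded D" by simp_all
    show "iso_arrow ?C (Assoc ?C A B D)"
      unfolding iso_arrow_def graded_category_simps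
      \<comment> \<open>The witness stays open until \<open>zassoc_inverse\<close> fixes its map as
        \<open>zassoc_inv\<close>.\<close>
      by (rule exI, rule inverse_arrowsI, simp, simp, rule zassoc_inverse) auto
  next
    fix f g h A A' B B' D D'
    assume "f \<in> Hom ?C A A'" "g \<in> Hom ?C B B'" "h \<in> Hom ?C D D'"
    then obtain \<phi> \<gamma> \<eta> where eq: "f = \<lparr>source = A, app = \<phi>, target = A'\<rparr>"
        "g = \<lparr>source = B, app = \<gamma>, target = B'\<rparr>" "h = \<lparr>source = D, app = \<eta>, target = D'\<rparr>"
      and [simp]: "centrally_graded A" "centrally_graded A'" "centrally_graded B"
        "centrally_graded B'" "centrally_graded D" "centrally_graded D'"
      and hom [simp]: "\<phi> \<in> graded_hom A A'" "\<gamma> \<in> graded_hom B B'" "\<eta> \<in> graded_hom D D'"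
      by (auto elim!: HomE)
    show "Assoc ?C A' B' D' \<cdot>\<^bsub>?C\<^esub> ((f \<odot>\<^bsub>?C\<^esub> g) \<odot>\<^bsub>?C\<^esub> h) = (f \<odot>\<^bsub>?C\<^esub> (g \<odot>\<^bsub>?C\<^esub> h)) \<cdot>\<^bsub>?C\<^esub> Assoc ?C A B D"
      unfolding eq graded_category_simps graded_arrow.simps
      by (rule arrow_eqI) (auto elim!: zprodE simp: hom[THEN graded_homD(1)])
  next
    fix A
    assume "A \<in> Obj ?C"
    then have [simp]: "centrally_graded A" by simp
    show "iso_arrow ?C (LUnit ?C A)"
      unfolding iso_arrow_def graded_category_simps
      by (rule exI, rule inverse_arrowsI, simp, simp, rule zlunit_inverse) auto
    show "iso_arrow ?C (RUnit ?C A)"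
      unfolding iso_arrow_def graded_category_simps
      by (rule exI, rule inverse_arrowsI, simp, simp, rule zrunit_inverse) auto
  next
    fix f A A'
    assume "f \<in> Hom ?C A A'"
    then obtain \<phi> where eq: "f = \<lparr>source = A, app = \<phi>, target = A'\<rparr>"
      and [simp]: "centrally_graded A" "centrally_graded A'" and hom [simp]: "\<phi> \<in> graded_hom A A'"
      by (rule HomE)
    \<comment> \<open>Naturality of the unit maps is equivariance of \<open>\<phi>\<close>: the
      class of \<open>scal x\<close> and \<open>m\<close> goes to \<open>x.\<phi>(m)\<close> one way
      and to \<open>\<phi>(x.m)\<close> the other.\<close>
    show "LUnit ?C A' \<cdot>\<^bsub>?C\<^esub> (Id ?C (UnitO ?C) \<odot>\<^bsub>?C\<^esub> f) = f \<cdot>\<^bsub>?C\<^esub> LUnit ?C A"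
      unfolding eq graded_category_simps graded_arrow.simps
      by (rule arrow_eqI) (auto elim!: zprodE zunitE simp: graded_homD[OF hom])
    show "RUnit ?C A' \<cdot>\<^bsub>?C\<^esub> (f \<odot>\<^bsub>?C\<^esub> Id ?C (UnitO ?C)) = f \<cdot>\<^bsub>?C\<^esub> RUnit ?C A"
      unfolding eq graded_category_simps graded_arrow.simps
      by (rule arrow_eqI) (auto elim!: zprodE zunitE simp: graded_homD[OF hom])
  next
    fix A B D E
    assume "A \<in> Obj ?C" "B \<in> Obj ?C" "D \<in> Obj ?C" "E \<in> Obj ?C"
    then have [simp]: "centrally_graded A" "centrally_graded B" "centrally_graded D"
      "centrally_graded E" by simp_all
    \<comment> \<open>Both paths send \<open>[[[a, b], d], e]\<close> to
      \<open>[a, [b, [d, e]]]\<close>.\<close>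
    show "(Id ?C A \<odot>\<^bsub>?C\<^esub> Assoc ?C B D E) \<cdot>\<^bsub>?C\<^esub> Assoc ?C A (B \<otimes>\<^bsub>?C\<^esub> D) E \<cdot>\<^bsub>?C\<^esub> (Assoc ?C A B D \<odot>\<^bsub>?C\<^esub> Id ?C E) =
        Assoc ?C A B (D \<otimes>\<^bsub>?C\<^esub> E) \<cdot>\<^bsub>?C\<^esub> Assoc ?C (A \<otimes>\<^bsub>?C\<^esub> B) D E"
      unfolding graded_category_simps graded_arrow.simps
      by (rule arrow_eqI) (auto elim!: zprodE)
  qed (simp_all add: Hom_iff)
qed

lemma strict_associators_graded: "strict_associators enc (graded_cat mult)"
  unfolding strict_associators_def by simp

section \<open>The braiding and symmetry axioms\<close>

lemma braided_graded:
  assumes "generalized_ring mult"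
  shows "braided_monoidal_category (graded_cat mult)"
proof -
  let ?C = "graded_cat mult"
  note [simp] = compose_eq
  interpret monoidal_category ?C by (rule monoidal_graded)
  interpret generalized_ring mult by (rule assms)
  show ?thesis
  proof
    fix A B
    assume "A \<in> Obj ?C" "B \<in> Obj ?C"
    then have [simp]: "centrally_graded A" "centrally_graded B" by simp_all
    show "Braid ?C A B \<in> Hom ?C (A \<otimes>\<^bsub>?C\<^esub> B) (B \<otimes>\<^bsub>?C\<^esub> A)"
      by (simp add: Hom_iff)
    show "iso_arrow ?C (Braid ?C A B)"
      unfolding iso_arrow_def graded_category_simps
      by (rule exI, rule inverse_arrowsI, simp, simp, rule braiding_inverse_uminus) auto
  next
    fix f g A A' B B'
    assume "f \<in> Hom ?C A A'" "g \<in> Hom ?C B B'"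
    then obtain \<phi> \<gamma> where eq: "f = \<lparr>source = A, app = \<phi>, target = A'\<rparr>"
        "g = \<lparr>source = B, app = \<gamma>, target = B'\<rparr>"
      and [simp]: "centrally_graded A" "centrally_graded A'" "centrally_graded B"
        "centrally_graded B'"
      and hom [simp]: "\<phi> \<in> graded_hom A A'" "\<gamma> \<in> graded_hom B B'"
      by (auto elim!: HomE)
    \<comment> \<open>Equivariance of this map moves the shift made by \<open>Braid ?C A B\<close>
      outward. The shifts on the two sides agree because \<open>\<phi>\<close> and
      \<open>\<gamma>\<close> preserve degrees.\<close>
    have zmap: "zmap enc enc B A B' A' \<gamma> \<phi> \<in> graded_hom (zprod enc B A) (zprod enc B' A')"
      by simp
    show "Braid ?C A' B' \<cdot>\<^bsub>?C\<^esub> (f \<odot>\<^bsub>?C\<^esub> g) = (g \<odot>\<^bsub>?C\<^esub> f) \<cdot>\<^bsub>?C\<^esub> Braid ?C A B"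
      unfolding eq graded_category_simps graded_arrow.simps
      by (rule arrow_eqI)
        (auto elim!: zprodE simp: hom[THEN graded_homD(1)] hom[THEN graded_homD(2)]
          graded_homD(3)[OF zmap])
  next
    fix A B D
    assume "A \<in> Obj ?C" "B \<in> Obj ?C" "D \<in> Obj ?C"
    then have cg [simp]: "centrally_graded A" "centrally_graded B" "centrally_graded D"
      by simp_all
    \<comment> \<open>These maps are applied after a braiding has produced a shift; being
      equivariant, they let the shift pass to the outside.\<close>
    have hom1: "zassoc enc B D A \<in>
        graded_hom (zprod enc (zprod enc B D) A) (zprod enc B (zprod enc D A))"
      "zassoc enc B A D \<in>
        graded_hom (zprod enc (zprod enc B A) D) (zprod enc B (zprod enc A D))"
      "zmap enc enc B (zprod enc A D) B (zprod enc D A)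
          (restrict id (carrier B)) (braiding enc enc mult A D) \<in>
        graded_hom (zprod enc B (zprod enc A D)) (zprod enc B (zprod enc D A))"
      by simp_all
    have hom2: "zassoc_inv D A B \<in>
        graded_hom (zprod enc D (zprod enc A B)) (zprod enc (zprod enc D A) B)"
      "zassoc_inv A D B \<in>
        graded_hom (zprod enc A (zprod enc D B)) (zprod enc (zprod enc A D) B)"
      "zmap enc enc (zprod enc A D) B (zprod enc D A) B
          (braiding enc enc mult A D) (restrict id (carrier B)) \<in>
        graded_hom (zprod enc (zprod enc A D) B) (zprod enc (zprod enc D A) B)"
      by simp_all
    \<comment> \<open>On \<open>[[a, b], d]\<close> the left side shifts by the product of
      \<open>deg B b + deg D d\<close> with \<open>deg A a\<close>, the right side by the sum of the
      two separate products: additivity in the first argument.\<close>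
    show "Assoc ?C B D A \<cdot>\<^bsub>?C\<^esub> Braid ?C A (B \<otimes>\<^bsub>?C\<^esub> D) \<cdot>\<^bsub>?C\<^esub> Assoc ?C A B D =
        (Id ?C B \<odot>\<^bsub>?C\<^esub> Braid ?C A D) \<cdot>\<^bsub>?C\<^esub> Assoc ?C B A D \<cdot>\<^bsub>?C\<^esub> (Braid ?C A B \<odot>\<^bsub>?C\<^esub> Id ?C D)"
      unfolding graded_category_simps graded_arrow.simps
      by (rule arrow_eqI) (auto elim!: zprodE simp: hom1[THEN graded_homD(3)] add_left add_right
          ac_simps)
    \<comment> \<open>The abstract inverses in the second hexagon are replaced by computable maps,
      while \<open>Assoc\<close> is still folded.\<close>
    have inv: "inv_arrow ?C (Assoc ?C A' B' D') =
        \<lparr>source = zprod enc A' (zprod enc B' D'), app = zassoc_inv A' B' D',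
         target = zprod enc (zprod enc A' B') D'\<rparr>"
      if "centrally_graded A'" "centrally_graded B'" "centrally_graded D'" for A' B' D'
      using that by (intro inv_arrowI) (simp add: inverse_arrowsI zassoc_inverse)
    \<comment> \<open>On \<open>[a, [b, d]]\<close> the two shifts are the product of
      \<open>deg D d\<close> with \<open>deg A a + deg B b\<close> and the sum of the separate
      products: additivity in the second argument.\<close>
    show "inv_arrow ?C (Assoc ?C D A B) \<cdot>\<^bsub>?C\<^esub> Braid ?C (A \<otimes>\<^bsub>?C\<^esub> B) D \<cdot>\<^bsub>?C\<^esub> inv_arrow ?C (Assoc ?C A B D) =
        (Braid ?C A D \<odot>\<^bsub>?C\<^esub> Id ?C B) \<cdot>\<^bsub>?C\<^esub> inv_arrow ?C (Assoc ?C A D B) \<cdot>\<^bsub>?C\<^esub> (Id ?C A \<odot>\<^bsub>?C\<^esub> Braid ?C B D)"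
      unfolding inv[OF cg(3,1,2)] inv[OF cg] inv[OF cg(1,3,2)]
      unfolding graded_category_simps graded_arrow.simps
      by (rule arrow_eqI) (auto elim!: zprodE simp: hom2[THEN graded_homD(3)] add_left add_right
          ac_simps)
  qed
qed

lemma symmetric_graded:
  assumes "generalized_ring mult" "skew mult"
  shows "symmetric_monoidal_category (graded_cat mult)"
proof -
  let ?C = "graded_cat mult"
  interpret braided_monoidal_category ?C by (rule braided_graded) fact
  \<comment> \<open>This is the hypothesis of \<open>braiding_inverse\<close> with
    \<open>mult' = mult\<close>.\<close>
  have opp: "mult a b + mult b a = 0" for a b
    using assms(2) unfolding skew_def by blast
  show ?thesis
  proof
    fix A B
    assume "A \<in> Obj ?C" "B \<in> Obj ?C"
    then show "inverse_arrows ?C (Braid ?C A B) (Braid ?C B A)"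
      unfolding graded_category_simps
      by (intro inverse_arrowsI braiding_inverse opp) auto
  qed
qed

end

text \<open>The first half concerns the quotient sets themselves, with arbitrary element types,
  hence \<open>enc = id\<close>. The categorical half needs a single type of objects and is stated
  for every universe.\<close>

theorem theorem0p6:
  fixes mult :: "'g::ab_group_add \<Rightarrow> 'g \<Rightarrow> 'g"
  assumes "generalized_ring mult"
  shows
    "(\<forall>(M1 :: ('g, 'a) graded_set) (M2 :: ('g, 'b) graded_set).
        centrally_graded M1 \<and> centrally_graded M2 \<longrightarrow>
          (\<lambda>(x1, x2). act (zprod id M2 M1) (mult (deg M2 x2) (deg M1 x1)) (zclass id M2 M1 x2 x1))
             respects zrel M1 M2 \<and>
          (\<forall>x1 \<in> carrier M1. \<forall>x2 \<in> carrier M2.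
             braiding id id mult M1 M2 (zclass id M1 M2 x1 x2) =
               act (zprod id M2 M1) (mult (deg M2 x2) (deg M1 x1)) (zclass id M2 M1 x2 x1)) \<and>
          graded_iso (zprod id M1 M2) (zprod id M2 M1) (braiding id id mult M1 M2) \<and>
          (skew mult \<longrightarrow>
             graded_inverse (zprod id M1 M2) (zprod id M2 M1)
               (braiding id id mult M1 M2) (braiding id id mult M2 M1))) \<and>
     (\<forall>(enc :: ('u \<times> 'u) set \<Rightarrow> 'u) (scal :: 'g \<Rightarrow> 'u).
        graded_universe enc scal \<longrightarrow>
          braided_monoidal_category (graded_category enc scal mult) \<and>
          strict_associators enc (graded_category enc scal mult) \<and>
          (skew mult \<longrightarrow> symmetric_monoidal_category (graded_category enc scal mult)))"
proof (intro conjI allI impI; (elim conjE)?)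
  fix M1 :: "('g, 'a) graded_set" and M2 :: "('g, 'b) graded_set"
  assume "centrally_graded M1" "centrally_graded M2"
  then have pairs: "coded_pair id M1 M2" "coded_pair id M2 M1"
    by (simp_all add: coded_pair_id)
  show "(\<lambda>(x1, x2). act (zprod id M2 M1) (mult (deg M2 x2) (deg M1 x1)) (zclass id M2 M1 x2 x1))
      respects zrel M1 M2"
    by (rule braiding_respects[OF pairs(2)])
  show "\<forall>x1 \<in> carrier M1. \<forall>x2 \<in> carrier M2.
      braiding id id mult M1 M2 (zclass id M1 M2 x1 x2) =
        act (zprod id M2 M1) (mult (deg M2 x2) (deg M1 x1)) (zclass id M2 M1 x2 x1)"
    by (simp add: braiding_zclass[OF pairs])
  show "graded_iso (zprod id M1 M2) (zprod id M2 M1) (braiding id id mult M1 M2)"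
    unfolding graded_iso_def using braiding_inverse_uminus[OF pairs] by blast
  assume "skew mult"
  then show "graded_inverse (zprod id M1 M2) (zprod id M2 M1)
      (braiding id id mult M1 M2) (braiding id id mult M2 M1)"
    unfolding skew_def by (intro braiding_inverse[OF pairs]) blast
next
  fix enc :: "('u \<times> 'u) set \<Rightarrow> 'u" and scal :: "'g \<Rightarrow> 'u"
  assume "graded_universe enc scal"
  then interpret graded_universe enc scal .
  show "braided_monoidal_category (graded_category enc scal mult)"
    by (rule braided_graded) fact
  show "strict_associators enc (graded_category enc scal mult)"
    by (rule strict_associators_graded)
  assume "skew mult"
  then show "symmetric_monoidal_category (graded_category enc scal mult)"
    by (rule symmetric_graded[OF assms])
qed

end
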